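(* Suppose a common cumulative proceeds curve $B$ has non-increasing marginal proceeds and $B(0)=0$. If each of $n$ positions, with quantities $q_1,\dots,q_n$, is valued independently from the same initial book, then $$\sum_{i=1}^{n}B(q_i)\ \ge\ B\Big(\sum_{i=1}^{n}q_i\Big),$$ with strict inequality whenever the aggregate sale walks into worse marginal levels not reached by every position individually.
   Context: There are $n$ positions in the same outcome token, all of which would be sold into the same bid book; position $i$ has quantity $q_i\ge 0$ of the token. $B(x)$, for $x\ge0$, is the cumulative net proceeds from selling $x$ units into that book starting from its top (best bid). The marginal proceeds at cumulative quantity $z$ are the net price obtained for the marginal unit sold there; "non-increasing marginal proceeds" means that this marginal price $p(z)\ge 0$ is non-increasing in $z$, with $B(x)=\int_0^x p(z)\,dz$ (on a finite step book, the corresponding sum over marginal lots). Valuing position $i$ independently from the same initial book means assigning it the value $B(q_i)$, as if it alone were sold starting from the top of the book; selling all positions together through the one book yields $B(\sum_i q_i)$. *)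

theory Defs
  imports "HOL-Analysis.Analysis"
begin

text \<open>
  \<open>p z\<close> is the net price of the marginal unit sold at cumulative quantity \<open>z\<close>. A finite step
  book is the case of a step function \<open>p\<close> (with value 0 beyond the depth of the book).
\<close>

definition nonincreasing_marginal_proceeds :: "(real \<Rightarrow> real) \<Rightarrow> (real \<Rightarrow> real) \<Rightarrow> bool" where
  "nonincreasing_marginal_proceeds p B \<longleftrightarrow>
     (\<forall>z\<ge>0. 0 \<le> p z) \<and>
     antimono_on {0..} p \<and>
     (\<forall>x\<ge>0. (p has_integral B x) {0..x})"

text \<open>
  The interval is half-open because a sale of \<open>x\<close> units consumes the marginal units at cumulative
  quantities \<open>0 \<le> z < x\<close>: if the price drops exactly at \<open>x\<close>, the lower level is not reached.
  In particular, an empty sale reaches no level.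
\<close>

definition levels_reached :: "(real \<Rightarrow> real) \<Rightarrow> real \<Rightarrow> real set" where
  "levels_reached p x = p ` {0..<x}"

text \<open>
  A sale of \<open>Q\<close> units walks into a level that a sale of \<open>x\<close> units does not reach and that is worse
  than what the latter obtains. The comparison with a level \<open>m\<close> that is reached by the sale of \<open>x\<close>
  units only excludes \<open>x = 0\<close>: for \<open>x > 0\<close> and non-increasing \<open>p\<close>, every level reached by
  \<open>Q\<close> and not by \<open>x\<close> is worse than all those reached by \<open>x\<close>.
\<close>

definition walks_into_worse_level :: "(real \<Rightarrow> real) \<Rightarrow> real \<Rightarrow> real \<Rightarrow> bool" where
  "walks_into_worse_level p Q x \<longleftrightarrow>
     (\<exists>l \<in> levels_reached p Q. l \<notin> levels_reached p x \<and> (\<exists>m \<in> levels_reached p x. l < m))"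

end

theory Submission imports Defs begin

text \<open>
  A sale of \<open>x\<close> units on its own earns \<open>p t\<close> on its marginal unit \<open>t\<close>, but only \<open>p (t + S)\<close> when it
  is executed after a sale of \<open>S\<close> other units; integrating the loss \<open>p t - p (t + S) \<ge> 0\<close> over
  \<open>{0..x}\<close> gives subadditivity. If the sale of \<open>x + S\<close> units reaches at some \<open>z < x + S\<close> a price
  strictly below all those reached by \<open>x\<close> units, the loss is bounded away from 0 on an interval of
  values of \<open>t\<close> between \<open>z - S\<close> and \<open>x\<close>, whence strictness.
\<close>

lemma proceeds_add_gap:
  assumes "nonincreasing_marginal_proceeds p B"
    and "0 \<le> S" "0 \<le> a" "a \<le> c" "c \<le> x"
    and gap: "\<And>t. t \<in> {a..c} \<Longrightarrow> d \<le> p t - p (t + S)"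
  shows "B (x + S) + d * (c - a) \<le> B x + B S"
proof -
  have anti: "antimono_on {0..} p" and int: "\<And>x. 0 \<le> x \<Longrightarrow> (p has_integral B x) {0..x}"
    using assms(1) by (auto simp: nonincreasing_marginal_proceeds_def)
  have x: "0 \<le> x" using assms by linarith
  have whole: "(p has_integral B (x + S)) {0..x + S}"
    using x \<open>0 \<le> S\<close> by (intro int) simp
  then have "p integrable_on {0..x + S}"
    by (rule has_integral_integrable)
  then have "p integrable_on {S..x + S}"
    by (rule integrable_on_subinterval) (use \<open>0 \<le> S\<close> in simp)
  then have tail: "(p has_integral (integral {S..x + S} p)) {S..x + S}"
    by (rule integrable_integral)
  have "(p has_integral (B S + integral {S..x + S} p)) {0..x + S}"
    by (rule has_integral_combine[OF _ _ int tail]) (use x \<open>0 \<le> S\<close> in auto)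
  then have "B (x + S) = B S + integral {S..x + S} p"
    by (rule has_integral_unique[OF whole])
  \<comment> \<open>The translation \<open>t + S\<close> carries the tail \<open>{S..x + S}\<close>,
    whose integral is \<open>B (x + S) - B S\<close>, back to \<open>{0..x}\<close>, where it can be
    compared with the integral of \<open>p\<close>.\<close>
  with tail have "(p has_integral (B (x + S) - B S)) (cbox S (x + S))"
    by simp
  from has_integral_affinity[OF this, of 1 S]
  have "((\<lambda>t. p (t + S)) has_integral (B (x + S) - B S)) {0..x}"
    by simp
  with int[OF x] have loss:
    "((\<lambda>t. p t - p (t + S)) has_integral (B x - (B (x + S) - B S))) {0..x}"
    by (rule has_integral_diff)
  have "((\<lambda>t. d) has_integral (d * (c - a))) {a..c}"
    using has_integral_const_real[of d a c] \<open>a \<le> c\<close> by (simp add: mult.commute)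
  \<comment> \<open>The loss is compared with a step function: it is at least \<open>d\<close> on
    \<open>{a..c}\<close> by \<open>gap\<close>, and at least 0 elsewhere by monotonicity.\<close>
  then have "((\<lambda>t. if t \<in> {a..c} then d else 0) has_integral (d * (c - a))) {0..x}"
    using assms by (subst has_integral_restrict) auto
  then have "d * (c - a) \<le> B x - (B (x + S) - B S)"
  proof (rule has_integral_le[OF _ loss])
    fix t assume t: "t \<in> {0..x}"
    have "p (t + S) \<le> p t"
      using t \<open>0 \<le> S\<close> by (intro monotone_onD[OF anti]) auto
    then show "(if t \<in> {a..c} then d else 0) \<le> p t - p (t + S)"
      using gap[of t] by auto
  qed
  then show ?thesis by simp
qed

lemma proceeds_subadditive:
  assumes "nonincreasing_marginal_proceeds p B" "0 \<le> x" "0 \<le> S"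
  shows "B (x + S) \<le> B x + B S"
proof -
  have "antimono_on {0..} p"
    using assms(1) by (simp add: nonincreasing_marginal_proceeds_def)
  \<comment> \<open>The degenerate interval \<open>{0..0}\<close> with \<open>d = 0\<close> leaves
    \<open>t = 0\<close> as the only gap to check.\<close>
  then have "p (0 + S) \<le> p 0"
    by (rule monotone_onD) (use \<open>0 \<le> S\<close> in auto)
  then show ?thesis
    using proceeds_add_gap[of p B S 0 0 x 0] assms by simp
qed

lemma proceeds_subadditive_strict:
  assumes nmp: "nonincreasing_marginal_proceeds p B" and "0 \<le> x" "0 \<le> S"
    and walks: "walks_into_worse_level p (x + S) x"
  shows "B (x + S) < B x + B S"
proof -
  have anti: "antimono_on {0..} p"
    using nmp by (simp add: nonincreasing_marginal_proceeds_def)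
  obtain z w where z: "0 \<le> z" "z < x + S" "p z \<notin> p ` {0..<x}" and w: "0 \<le> w" "w < x" "p z < p w"
    using walks by (auto simp: walks_into_worse_level_def levels_reached_def)
  \<comment> \<open>If \<open>z < x\<close>, the level \<open>p z\<close> would be reached by the
    sale of \<open>x\<close> units; so \<open>x \<le> z\<close>, and monotonicity is strict because
    \<open>p z\<close> is not attained before \<open>x\<close>.\<close>
  have below: "p z < p t" if "0 \<le> t" "t < x" for t
  proof -
    have "x \<le> z"
      using z by (metis atLeastLessThan_iff image_eqI not_le)
    then have "p z \<le> p t"
      using that by (intro monotone_onD[OF anti]) auto
    moreover have "p t \<noteq> p z"
      using z(3) that by (metis atLeastLessThan_iff image_eqI)
    ultimately show ?thesis by simp
  qed
  \<comment> \<open>From \<open>a\<close> on, the shifted unit \<open>t + S\<close> lies at or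
    beyond \<open>z\<close>, hence costs at most \<open>p z\<close> in price level. Here
    \<open>a < x\<close> because \<open>z < x + S\<close> and \<open>w\<close> witnesses
    \<open>0 < x\<close>. The midpoint \<open>c\<close> stays strictly below \<open>x\<close>, since
    \<open>p x\<close> itself may equal \<open>p z\<close>.\<close>
  define a where "a = max 0 (z - S)"
  define c where "c = (a + x) / 2"
  have ac: "0 \<le> a" "a < c" "c < x"
    using z w by (auto simp: a_def c_def)
  have "p c - p z \<le> p t - p (t + S)" if "t \<in> {a..c}" for t
  proof -
    have "p c \<le> p t"
      using that ac by (intro monotone_onD[OF anti]) auto
    moreover have "p (t + S) \<le> p z"
      using that z by (intro monotone_onD[OF anti]) (auto simp: a_def)
    ultimately show ?thesis by simp
  qed
  then have "B (x + S) + (p c - p z) * (c - a) \<le> B x + B S"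
    using ac \<open>0 \<le> S\<close> by (intro proceeds_add_gap[OF nmp]) auto
  \<comment> \<open>Both factors are positive: \<open>below\<close> applies at \<open>c < x\<close>,
    and \<open>a < c\<close>.\<close>
  moreover have "0 < (p c - p z) * (c - a)"
    using below[of c] ac by simp
  ultimately show ?thesis by linarith
qed

text \<open>The index set is an arbitrary finite set so that the bound also covers all positions but
  one, as the strict case requires.\<close>

lemma proceeds_sum_le:
  assumes nmp: "nonincreasing_marginal_proceeds p B" and "B 0 = 0"
    and "finite I" and "\<And>i. i \<in> I \<Longrightarrow> 0 \<le> q i"
  shows "B (\<Sum>i\<in>I. q i) \<le> (\<Sum>i\<in>I. B (q i))"
  using \<open>finite I\<close> assms(4)
proof (induction I)
  case empty
  then show ?case using \<open>B 0 = 0\<close> by simp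
next
  case (insert i I)
  have "B (q i + sum q I) \<le> B (q i) + B (sum q I)"
    using insert by (intro proceeds_subadditive[OF nmp] sum_nonneg) auto
  then show ?case using insert by force
qed

theorem proposition8p1:
  fixes p B :: "real \<Rightarrow> real" and n :: nat and q :: "nat \<Rightarrow> real"
  assumes "nonincreasing_marginal_proceeds p B"
    and "B 0 = 0"
    and "\<And>i. i \<in> {1..n} \<Longrightarrow> 0 \<le> q i"
  shows "(\<Sum>i=1..n. B (q i)) \<ge> B (\<Sum>i=1..n. q i) \<and>
    ((\<exists>i\<in>{1..n}. walks_into_worse_level p (\<Sum>j=1..n. q j) (q i)) \<longrightarrow>
      (\<Sum>i=1..n. B (q i)) > B (\<Sum>i=1..n. q i))"
proof (intro conjI impI)
  show "B (\<Sum>i=1..n. q i) \<le> (\<Sum>i=1..n. B (q i))"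
    using assms by (intro proceeds_sum_le) auto
  assume "\<exists>i\<in>{1..n}. walks_into_worse_level p (\<Sum>j=1..n. q j) (q i)"
  then obtain i where i: "i \<in> {1..n}" "walks_into_worse_level p (\<Sum>j=1..n. q j) (q i)"
    by blast
  \<comment> \<open>The position \<open>i\<close> is split off: strictness comes from the pair
    \<open>q i\<close>, \<open>S\<close>, and the weak inequality suffices for the others.\<close>
  define S where "S = sum q ({1..n} - {i})"
  have total: "(\<Sum>j=1..n. q j) = q i + S"
    unfolding S_def using i by (intro sum.remove) auto
  have "0 \<le> S"
    unfolding S_def using assms(3) by (intro sum_nonneg) auto
  then have "B (q i + S) < B (q i) + B S"
    using i assms(3) total by (intro proceeds_subadditive_strict[OF assms(1)]) auto
  also have "B S \<le> (\<Sum>j\<in>{1..n} - {i}. B (q j))"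
    unfolding S_def using assms by (intro proceeds_sum_le) auto
  also have "B (q i) + (\<Sum>j\<in>{1..n} - {i}. B (q j)) = (\<Sum>j=1..n. B (q j))"
    using i by (intro sum.remove[symmetric]) auto
  finally show "B (\<Sum>i=1..n. q i) < (\<Sum>i=1..n. B (q i))"
    using total by simp
qed

end
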